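(* Let $\Gamma\subset\mathbb R$ be an additive subgroup containing $\mathbb Z$. The set $\mathcal V_{\mathrm{flat}}$ is exactly the smallest two-sided ideal of $\mathcal A_\Gamma$ that contains all flat convolution generators $V_k$, $k\in\mathcal M$.
   Context: Fix $T>0$; functions are complex-valued. Let $\mathcal M=\{f\in C^\infty[0,T]: f^{(n)}(0)=0\text{ for all }n\ge 0\}$. For $\mu>0$ put $(J^\mu f)(t)=\frac1{\Gamma(\mu)}\int_0^t(t-s)^{\mu-1}f(s)\,ds$ (here $\Gamma(\cdot)$ is the gamma function). On $\mathcal M$ define $D^{-\mu}=J^\mu$ for $\mu>0$, $D^0=I$, and for $\alpha>0$, $D^\alpha f=J^{n-\alpha}f^{(n)}$ for any integer $n>\alpha$; each $D^\alpha$, $\alpha\in\mathbb R$, is a bijection of $\mathcal M$ and $D^\alpha D^\beta=D^{\alpha+\beta}$. For $p\in\mathbb C[t]$, $M_p$ is multiplication by $p$. For $k\in\mathcal M$, $(V_kf)(t)=\int_0^tk(t-s)f(s)\,ds$; for a bivariate kernel $K$ on $\{0\le s\le t\le T\}$, $(V_Kf)(t)=\int_0^tK(t,s)f(s)\,ds$. $\mathcal K_{\mathrm{flat}}$ is the set of finite sums $K(t,s)=\sum_{r=1}^{N}p_r(t)k_r(t-s)$ with $p_r\in\mathbb C[t]$, $k_r\in\mathcal M$, and $\mathcal V_{\mathrm{flat}}=\{V_K:K\in\mathcal K_{\mathrm{flat}}\}$. $\mathcal A_\Gamma$ is the subalgebra of $\operatorname{End}_{\mathbb C}(\mathcal M)$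 generated by $\{M_p:p\in\mathbb C[t]\}$, $\{D^\gamma:\gamma\in\Gamma\}$ and $\{V_k:k\in\mathcal M\}$. *)

theory Defs
  imports
    "HOL-Analysis.Analysis"
    "HOL-Computational_Algebra.Polynomial"
    "HOL-Algebra.Ideal"
    "HOL-Algebra.Embedded_Algebras"
begin

text \<open>
  A function on \<open>[0,T]\<close> is represented by its extension by \<open>0\<close> to the whole real line, so that
  equality of representatives is equality on \<open>[0,T]\<close>. Derivatives are taken within \<open>[0,T]\<close>,
  hence are one-sided at the end points.
\<close>

definition deriv_on :: "real \<Rightarrow> (real \<Rightarrow> complex) \<Rightarrow> real \<Rightarrow> complex" where
  "deriv_on T f = (\<lambda>t. if t \<in> {0..T} then vector_derivative f (at t within {0..T}) else 0)"

definition flat_space :: "real \<Rightarrow> (real \<Rightarrow> complex) set" where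
  "flat_space T = {f. (\<forall>t. t \<notin> {0..T} \<longrightarrow> f t = 0) \<and>
     (\<forall>n. \<forall>t\<in>{0..T}. (deriv_on T ^^ n) f differentiable (at t within {0..T})) \<and>
     (\<forall>n. (deriv_on T ^^ n) f 0 = 0)}"

definition frac_int :: "real \<Rightarrow> real \<Rightarrow> (real \<Rightarrow> complex) \<Rightarrow> real \<Rightarrow> complex" where
  "frac_int T \<mu> f = (\<lambda>t. if t \<in> {0..T}
     then (1 / Gamma \<mu>) *\<^sub>R integral {0..t} (\<lambda>s. ((t - s) powr (\<mu> - 1)) *\<^sub>R f s) else 0)"

text \<open>
  For \<open>\<alpha> > 0\<close> the value of \<open>J\<^sup>n\<^sup>-\<^sup>\<alpha> f\<^sup>(\<^sup>n\<^sup>)\<close> on \<^const>\<open>flat_space\<close> is the same for every integer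
  \<open>n > \<alpha>\<close>; the least such \<open>n\<close> is used.
\<close>

definition frac_deriv :: "real \<Rightarrow> real \<Rightarrow> (real \<Rightarrow> complex) \<Rightarrow> real \<Rightarrow> complex" where
  "frac_deriv T \<alpha> f =
     (if \<alpha> < 0 then frac_int T (- \<alpha>) f
      else if \<alpha> = 0 then f
      else (let n = nat (\<lfloor>\<alpha>\<rfloor> + 1) in frac_int T (real n - \<alpha>) ((deriv_on T ^^ n) f)))"

text \<open>
  Operators on \<^const>\<open>flat_space\<close> are functions restricted to it (\<^const>\<open>extensional\<close>), so
  that equality of operators is equality on \<^const>\<open>flat_space\<close>.
\<close>

definition End_flat :: "real \<Rightarrow> ((real \<Rightarrow> complex) \<Rightarrow> (real \<Rightarrow> complex)) ring" where
  "End_flat T = \<lparr>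
     carrier = {L. L \<in> flat_space T \<rightarrow>\<^sub>E flat_space T \<and>
       (\<forall>f\<in>flat_space T. \<forall>g\<in>flat_space T. L (\<lambda>t. f t + g t) = (\<lambda>t. L f t + L g t)) \<and>
       (\<forall>c. \<forall>f\<in>flat_space T. L (\<lambda>t. c * f t) = (\<lambda>t. c * L f t))},
     mult = (\<lambda>L L'. compose (flat_space T) L L'),
     one = (\<lambda>f\<in>flat_space T. f),
     zero = (\<lambda>f\<in>flat_space T. \<lambda>t. 0),
     add = (\<lambda>L L'. \<lambda>f\<in>flat_space T. \<lambda>t. L f t + L' f t)\<rparr>"

definition scalar_op :: "real \<Rightarrow> complex \<Rightarrow> (real \<Rightarrow> complex) \<Rightarrow> (real \<Rightarrow> complex)" where
  "scalar_op T c = (\<lambda>f\<in>flat_space T. \<lambda>t. c * f t)"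

definition mult_op :: "real \<Rightarrow> complex poly \<Rightarrow> (real \<Rightarrow> complex) \<Rightarrow> (real \<Rightarrow> complex)" where
  "mult_op T p = (\<lambda>f\<in>flat_space T. \<lambda>t. poly p (of_real t) * f t)"

definition frac_op :: "real \<Rightarrow> real \<Rightarrow> (real \<Rightarrow> complex) \<Rightarrow> (real \<Rightarrow> complex)" where
  "frac_op T \<alpha> = (\<lambda>f\<in>flat_space T. frac_deriv T \<alpha> f)"

definition volterra_op ::
  "real \<Rightarrow> (real \<Rightarrow> real \<Rightarrow> complex) \<Rightarrow> (real \<Rightarrow> complex) \<Rightarrow> (real \<Rightarrow> complex)" where
  "volterra_op T K =
     (\<lambda>f\<in>flat_space T. \<lambda>t. if t \<in> {0..T} then integral {0..t} (\<lambda>s. K t s * f s) else 0)"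

definition conv_op :: "real \<Rightarrow> (real \<Rightarrow> complex) \<Rightarrow> (real \<Rightarrow> complex) \<Rightarrow> (real \<Rightarrow> complex)" where
  "conv_op T k = volterra_op T (\<lambda>t s. k (t - s))"

text \<open>
  Kernels live on the triangle \<open>0 \<le> s \<le> t \<le> T\<close>; their values elsewhere are arbitrary and do
  not enter \<^const>\<open>volterra_op\<close>.
\<close>

definition flat_kernels :: "real \<Rightarrow> (real \<Rightarrow> real \<Rightarrow> complex) set" where
  "flat_kernels T = {K. \<exists>(N::nat) (p :: nat \<Rightarrow> complex poly) (k :: nat \<Rightarrow> real \<Rightarrow> complex).
     (\<forall>r\<in>{1..N}. k r \<in> flat_space T) \<and>
     (\<forall>t s. 0 \<le> s \<and> s \<le> t \<and> t \<le> T \<longrightarrow>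
        K t s = (\<Sum>r=1..N. poly (p r) (of_real t) * k r (t - s)))}"

definition flat_volterra :: "real \<Rightarrow> ((real \<Rightarrow> complex) \<Rightarrow> (real \<Rightarrow> complex)) set" where
  "flat_volterra T = volterra_op T ` flat_kernels T"

text \<open>
  In the library, \<^const>\<open>subalgebra\<close> only asks for a linear subspace (over the given scalars);
  closure under products and the unit come from \<^const>\<open>subring\<close>.
\<close>

definition generated_subalgebra ::
  "real \<Rightarrow> ((real \<Rightarrow> complex) \<Rightarrow> (real \<Rightarrow> complex)) set \<Rightarrow> ((real \<Rightarrow> complex) \<Rightarrow> (real \<Rightarrow> complex)) set" where
  "generated_subalgebra T G = \<Inter>{S. subring S (End_flat T) \<and>
     subalgebra (range (scalar_op T)) S (End_flat T) \<and> G \<subseteq> S}"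

definition frac_algebra :: "real \<Rightarrow> real set \<Rightarrow> ((real \<Rightarrow> complex) \<Rightarrow> (real \<Rightarrow> complex)) ring" where
  "frac_algebra T \<Gamma> = (End_flat T)\<lparr>carrier := generated_subalgebra T
     (range (mult_op T) \<union> frac_op T ` \<Gamma> \<union> conv_op T ` flat_space T)\<rparr>"

end

theory Submission
  imports Defs
begin

text \<open>
  Write \<open>M\<close> for the space of flat functions, \<open>V\<^sub>w\<close> for convolution with a kernel \<open>w\<close>, \<open>X\<close> for
  multiplication by the coordinate and \<open>\<partial>\<close> for differentiation. A fractional operator of
  nonzero order is \<open>V\<^sub>w \<partial>\<^sup>n\<close> on \<open>M\<close> with an integrable power kernel \<open>w\<close>, so every generator of the algebra is
  composed of scalars, \<open>X\<close>, \<open>\<partial>\<close> and operators \<open>V\<^sub>w\<close> with \<open>w\<close> integrable on \<open>[0,T]\<close>: the weakly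
  singular kernels of fractional integration and the flat kernels are treated alike.

  On the other side, the operators with flat polynomial kernels form the smallest class that
  contains \<open>V\<^sub>k\<close> for flat \<open>k\<close> and is closed under sums and left multiplication by \<open>X\<close>
  (\<open>flat_volterra_eq_flat_span\<close>). Two-sided absorption is therefore checked by induction along
  these constructors, using three kinds of relations:
  \<^item> \<open>V\<^sub>w V\<^sub>k = V\<^sub>k V\<^sub>w = V\<^bsub>w*k\<^esub>\<close>, where \<open>w*k\<close> is again flat;
  \<^item> \<open>\<partial> V\<^sub>k = V\<^sub>k \<partial> = V\<^bsub>k'\<^esub>\<close>;
  \<^item> \<open>\<partial> X = 1 + X \<partial>\<close> and \<open>V\<^sub>w X = X V\<^sub>w - V\<^bsub>xw\<^esub>\<close>.

  The last relation replaces \<open>w\<close> by \<open>x w(x)\<close>, which is still integrable, so the induction has to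
  run for all integrable kernels at once. The operators that multiply the class into itself from
  both sides form a subring (\<open>idealizer\<close>); since it contains the generators, it contains the
  algebra, and the class is an ideal. Conversely an ideal that contains all \<open>V\<^sub>k\<close> is closed under
  sums and under multiplication by \<open>X\<close>, hence contains the whole class.

  The analysis behind the relations is one application of Fubini's theorem: convolution
  operators commute (\<open>conv_left_commute\<close>). A flat \<open>f\<close> is \<open>1 * f'\<close>, the convolution of its
  derivative with the constant kernel, so \<open>w * f = w * (1 * f') = 1 * (w * f')\<close>. This exhibits
  \<open>w * f\<close> as an integral, which gives continuity, differentiability and \<open>(w * f)' = w * f'\<close>
  for every integrable \<open>w\<close>.
\<close>

section \<open>Convolution on an interval\<close>

definition integrable_kernels :: "real \<Rightarrow> (real \<Rightarrow> complex) set" where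
  "integrable_kernels T = {w. integrable lborel w \<and> (\<forall>s. s \<notin> {0..T} \<longrightarrow> w s = 0)}"

definition bounded_functions :: "real \<Rightarrow> (real \<Rightarrow> complex) set" where
  "bounded_functions T = {f. f \<in> borel_measurable borel \<and> bounded (range f) \<and>
     (\<forall>s. s \<notin> {0..T} \<longrightarrow> f s = 0)}"

text \<open>
  Both arguments vanish outside \<open>[0,T]\<close> in all uses, so for \<open>t\<close> in \<open>[0,T]\<close> the integral over
  the line is the integral over \<open>[0,t]\<close>; integrating over the line keeps the domain of
  integration independent of \<open>t\<close> when integrals are interchanged.
\<close>

definition conv :: "real \<Rightarrow> (real \<Rightarrow> complex) \<Rightarrow> (real \<Rightarrow> complex) \<Rightarrow> real \<Rightarrow> complex" where
  "conv T w f = (\<lambda>t. if t \<in> {0..T} then LINT s|lborel. w s * f (t - s) else 0)"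

lemma conv_outside: "t \<notin> {0..T} \<Longrightarrow> conv T w f t = 0"
  unfolding conv_def by (rule if_not_P)

lemma integrable_kernels_measurable:
  "w \<in> integrable_kernels T \<Longrightarrow> w \<in> borel_measurable borel"
  by (auto simp: integrable_kernels_def dest: borel_measurable_integrable)

lemma bounded_functions_bound:
  assumes "f \<in> bounded_functions T"
  obtains M where "M \<ge> 0" "\<And>s. norm (f s) \<le> M"
  using assms by (auto simp: bounded_functions_def bounded_iff) (meson norm_ge_zero order_trans)

lemma bounded_functions_integrable_kernels:
  assumes "f \<in> bounded_functions T"
  shows "f \<in> integrable_kernels T"
proof -
  obtain M where M: "M \<ge> 0" "\<And>s. norm (f s) \<le> M"
    using bounded_functions_bound[OF assms] by blast
  have "integrable lborel (\<lambda>s::real. M * indicator {0..T} s)"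
    by (auto intro!: integrable_mult_right integrable_real_indicator simp: emeasure_lborel_Icc_eq)
  moreover have "f \<in> borel_measurable lborel"
    using assms by (simp add: bounded_functions_def)
  ultimately have "integrable lborel f"
    by (rule Bochner_Integration.integrable_bound)
       (use assms M in \<open>auto simp: bounded_functions_def indicator_def\<close>)
  then show ?thesis
    using assms by (auto simp: bounded_functions_def integrable_kernels_def)
qed

lemma conv_integrand_integrable:
  assumes "w \<in> integrable_kernels T" "f \<in> bounded_functions T"
  shows "integrable lborel (\<lambda>s. w s * f (t - s))"
proof -
  obtain M where M: "M \<ge> 0" "\<And>s. norm (f s) \<le> M"
    using bounded_functions_bound[OF assms(2)] by blast
  have [measurable]: "f \<in> borel_measurable borel" "w \<in> borel_measurable borel"
    using assms integrable_kernels_measurable by (auto simp: bounded_functions_def)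
  have "integrable lborel (\<lambda>s. M * norm (w s))"
    using assms by (auto simp: integrable_kernels_def)
  then show ?thesis
    by (rule Bochner_Integration.integrable_bound)
       (use M in \<open>auto simp: norm_mult mult.commute[of M] intro!: mult_left_mono\<close>)
qed

lemma conv_bounded_functions:
  assumes "w \<in> integrable_kernels T" "f \<in> bounded_functions T"
  shows "conv T w f \<in> bounded_functions T"
proof -
  obtain M where M: "M \<ge> 0" "\<And>s. norm (f s) \<le> M"
    using bounded_functions_bound[OF assms(2)] by blast
  have [measurable]: "f \<in> borel_measurable borel" "w \<in> borel_measurable borel"
    using assms integrable_kernels_measurable by (auto simp: bounded_functions_def)
  have "conv T w f \<in> borel_measurable borel"
    unfolding conv_def by measurable
  moreover have "norm (conv T w f t) \<le> (LINT s|lborel. M * norm (w s))" for t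
  proof -
    have "norm (LINT s|lborel. w s * f (t - s)) \<le> (LINT s|lborel. norm (w s * f (t - s)))"
      by (rule integral_norm_bound)
    also have "\<dots> \<le> (LINT s|lborel. M * norm (w s))"
      using conv_integrand_integrable[OF assms, of t] assms M
      by (intro integral_mono integrable_mult_right integrable_norm)
         (auto simp: integrable_kernels_def norm_mult mult.commute[of M] intro!: mult_left_mono)
    finally have *: "norm (LINT s|lborel. w s * f (t - s)) \<le> (LINT s|lborel. M * norm (w s))" .
    have "0 \<le> (LINT s|lborel. M * norm (w s))"
      by (rule integral_nonneg_AE) (use M in auto)
    with * show ?thesis by (auto simp: conv_def)
  qed
  ultimately show ?thesis
    using conv_outside unfolding bounded_functions_def bounded_iff by blast
qed

lemma conv_commute: "conv T w f = conv T f w"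
proof -
  have "(LINT s|lborel. w s * f (t - s)) = (LINT s|lborel. f s * w (t - s))" for t
    using lborel_integral_real_affine[of "-1" "\<lambda>s. w s * f (t - s)" t] by (simp add: mult.commute)
  then show ?thesis unfolding conv_def by presburger
qed

lemma conv_eq_integral:
  assumes "w \<in> integrable_kernels T" "f \<in> bounded_functions T" "t \<in> {0..T}"
  shows "conv T w f t = integral {0..t} (\<lambda>s. w (t - s) * f s)"
proof -
  have eq: "f s * w (t - s) = indicator {0..t} s *\<^sub>R (w (t - s) * f s)" for s
    using assms by (auto simp: integrable_kernels_def bounded_functions_def indicator_def)
  have "integrable lborel (\<lambda>s. f s * w (t - s))"
  proof -
    have "integrable lborel (\<lambda>s. w (t + - 1 * s) * f (t - (t + - 1 * s)))"
      by (rule lborel_integrable_real_affine) (use conv_integrand_integrable[OF assms(1,2)] in auto)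
    then show ?thesis by (simp add: mult.commute)
  qed
  then have "set_integrable lborel {0..t} (\<lambda>s. w (t - s) * f s)"
    unfolding set_integrable_def using eq by simp
  from set_borel_integral_eq_integral(2)[OF this]
  have "(LINT s|lborel. f s * w (t - s)) = integral {0..t} (\<lambda>s. w (t - s) * f s)"
    unfolding set_lebesgue_integral_def using eq by simp
  then show ?thesis
    using assms(3) conv_commute[of T w f] by (simp add: conv_def)
qed

text \<open>
  Written as a double integral, \<open>v * (w * f)\<close> at \<open>t\<close> is the integral of
  \<open>v(s) w(u) f(t - s - u)\<close>, which is symmetric in \<open>v\<close> and \<open>w\<close>; as \<open>f\<close> is bounded, the
  integrand is dominated by a multiple of the integrable \<open>v(s) w(u)\<close>, and Fubini's theorem
  applies.
\<close>

lemma conv_left_commute: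
  assumes "v \<in> integrable_kernels T" "w \<in> integrable_kernels T" "f \<in> bounded_functions T"
  shows "conv T v (conv T w f) = conv T w (conv T v f)"
proof (rule ext)
  fix t
  have unfold: "conv T a (conv T b f) t =
      (LINT s|lborel. LINT u|lborel. a s * b u * f (t - s - u))"
    if "a \<in> integrable_kernels T" "b \<in> integrable_kernels T" "t \<in> {0..T}" for a b
  proof -
    have "a s * conv T b f (t - s) = (LINT u|lborel. a s * b u * f (t - s - u))" for s
    proof (cases "s \<in> {0..T}")
      case False
      then show ?thesis using that by (simp add: integrable_kernels_def)
    next
      case s: True
      show ?thesis
      \<comment> \<open>The cut-off in the inner convolution at negative arguments is invisible: for \<open>s > t\<close>
        one of \<open>b u\<close> and \<open>f (t - s - u)\<close> always vanishes.\<close>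
      proof (cases "s \<le> t")
        case True
        then show ?thesis using s that by (simp add: conv_def mult.assoc)
      next
        case False
        then have "b u * f (t - s - u) = 0" for u
          using that assms by (cases "u < 0") (auto simp: integrable_kernels_def bounded_functions_def)
        then have "(LINT u|lborel. a s * b u * f (t - s - u)) = 0"
          by (simp only: mult.assoc mult_zero_right integral_zero)
        then show ?thesis using False by (simp add: conv_def)
      qed
    qed
    then show ?thesis using that(3) by (simp add: conv_def)
  qed
  show "conv T v (conv T w f) t = conv T w (conv T v f) t"
  proof (cases "t \<in> {0..T}")
    case False
    then show ?thesis by (metis conv_outside)
  next
    case True
    obtain M where M: "M \<ge> 0" "\<And>s. norm (f s) \<le> M"
      using bounded_functions_bound[OF assms(3)] by blast
    have [measurable]: "f \<in> borel_measurable borel" "w \<in> borel_measurable borel"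
      "v \<in> borel_measurable borel"
      using assms integrable_kernels_measurable by (auto simp: bounded_functions_def)
    have int: "integrable lborel v" "integrable lborel w"
      using assms by (auto simp: integrable_kernels_def)
    have "integrable (lborel \<Otimes>\<^sub>M lborel) (\<lambda>p. v (fst p) * w (snd p))"
      by (rule lborel_pair.Fubini_integrable) (use int in \<open>auto simp: norm_mult\<close>)
    then have "integrable (lborel \<Otimes>\<^sub>M lborel) (\<lambda>p. M * norm (v (fst p) * w (snd p)))"
      by auto
    then have "integrable (lborel \<Otimes>\<^sub>M lborel) (\<lambda>(s, u). v s * w u * f (t - s - u))"
      by (rule Bochner_Integration.integrable_bound)
         (use M in \<open>auto simp: norm_mult mult.commute[of M] split_beta intro!: mult_left_mono\<close>)
    from lborel_pair.Fubini_integral[OF this]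
    have "(LINT s|lborel. LINT u|lborel. v s * w u * f (t - s - u)) =
        (LINT u|lborel. LINT s|lborel. v s * w u * f (t - s - u))" ..
    also have "\<dots> = (LINT u|lborel. LINT s|lborel. w u * v s * f (t - u - s))"
      by (simp add: algebra_simps)
    finally show ?thesis using unfold assms True by simp
  qed
qed

lemma conv_assoc:
  assumes "w \<in> integrable_kernels T" "k \<in> bounded_functions T" "f \<in> bounded_functions T"
  shows "conv T (conv T w k) f = conv T w (conv T k f)"
  using conv_left_commute[OF assms(1) bounded_functions_integrable_kernels[OF assms(3)] assms(2)]
  by (metis conv_commute)

lemma conv_add_right:
  assumes "w \<in> integrable_kernels T" "f \<in> bounded_functions T" "g \<in> bounded_functions T"
  shows "conv T w (\<lambda>t. f t + g t) = (\<lambda>t. conv T w f t + conv T w g t)"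
  using conv_integrand_integrable[OF assms(1,2)] conv_integrand_integrable[OF assms(1,3)]
  by (auto simp: conv_def distrib_left)

lemma conv_scale_right: "conv T w (\<lambda>t. c * f t) = (\<lambda>t. c * conv T w f t)"
  by (auto simp: conv_def mult.left_commute)

lemma conv_scale_left: "conv T (\<lambda>t. c * w t) f = (\<lambda>t. c * conv T w f t)"
  by (metis conv_commute conv_scale_right)

section \<open>The idealizer of an additive subgroup\<close>

lemma (in ring) idealizer_subring:
  assumes "subgroup I (add_monoid R)"
  shows "subring {a \<in> carrier R. \<forall>x\<in>I. a \<otimes> x \<in> I \<and> x \<otimes> a \<in> I} R"
proof -
  have sub: "x \<in> carrier R" if "x \<in> I" for x
    using subgroup.mem_carrier[OF assms that] by simp
  have add: "x \<oplus> y \<in> I" if "x \<in> I" "y \<in> I" for x y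
    using subgroup.m_closed[OF assms that] by simp
  have neg: "\<ominus> x \<in> I" if "x \<in> I" for x
    using subgroup.m_inv_closed[OF assms that] by (simp add: a_inv_def)
  show ?thesis
  proof (rule subringI)
    fix a b
    assume "a \<in> {a \<in> carrier R. \<forall>x\<in>I. a \<otimes> x \<in> I \<and> x \<otimes> a \<in> I}"
      and "b \<in> {a \<in> carrier R. \<forall>x\<in>I. a \<otimes> x \<in> I \<and> x \<otimes> a \<in> I}"
    then have *: "a \<in> carrier R" "b \<in> carrier R"
      "\<And>x. x \<in> I \<Longrightarrow> a \<otimes> x \<in> I" "\<And>x. x \<in> I \<Longrightarrow> x \<otimes> a \<in> I"
      "\<And>x. x \<in> I \<Longrightarrow> b \<otimes> x \<in> I" "\<And>x. x \<in> I \<Longrightarrow> x \<otimes> b \<in> I"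
      by auto
    have "x \<otimes> (a \<otimes> b) \<in> I" if "x \<in> I" for x
      using * sub[OF that] that by (simp flip: m_assoc)
    then show "a \<otimes> b \<in> {a \<in> carrier R. \<forall>x\<in>I. a \<otimes> x \<in> I \<and> x \<otimes> a \<in> I}"
      using * by (simp add: m_assoc sub)
    show "a \<oplus> b \<in> {a \<in> carrier R. \<forall>x\<in>I. a \<otimes> x \<in> I \<and> x \<otimes> a \<in> I}"
      using * by (simp add: l_distr r_distr sub add)
  qed (simp_all add: sub neg l_minus r_minus subset_iff)
qed

section \<open>Flat functions\<close>

locale interval =
  fixes T :: real
  assumes T_pos: "0 < T"
begin

abbreviation (input) flat (\<open>\<M>\<close>) where "\<M> \<equiv> flat_space T"
abbreviation (input) \<delta> where "\<delta> \<equiv> deriv_on T"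

lemma deriv_on_eqI:
  assumes "\<And>t. t \<in> {0..T} \<Longrightarrow> (f has_vector_derivative f' t) (at t within {0..T})"
    "\<And>t. t \<notin> {0..T} \<Longrightarrow> f' t = 0"
  shows "\<delta> f = f'"
  using assms vector_derivative_within_closed_interval[OF T_pos, of _ f]
  by (auto simp: deriv_on_def)

text \<open>
  Smoothness and flatness follow from stability of a class of functions under differentiation.
  This avoids formulas for higher derivatives when closure properties of the space are proved.
\<close>

lemma flat_coinduct:
  assumes "f \<in> S"
    and "\<And>g. g \<in> S \<Longrightarrow> g 0 = 0"
    and "\<And>g t. g \<in> S \<Longrightarrow> t \<notin> {0..T} \<Longrightarrow> g t = 0"
    and "\<And>g. g \<in> S \<Longrightarrow> \<exists>g'\<in>S. \<forall>t\<in>{0..T}. (g has_vector_derivative g' t) (at t within {0..T})"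
  shows "f \<in> \<M>"
proof -
  have step: "\<delta> g \<in> S" if "g \<in> S" for g
  proof -
    obtain g' where g': "g' \<in> S" "\<forall>t\<in>{0..T}. (g has_vector_derivative g' t) (at t within {0..T})"
      using assms(4)[OF \<open>g \<in> S\<close>] by blast
    then have "\<delta> g = g'"
      using assms(3) by (intro deriv_on_eqI) auto
    with g' show ?thesis by simp
  qed
  have "(\<delta> ^^ n) f \<in> S" for n
    by (induction n) (use assms(1) step in auto)
  moreover have "g differentiable (at t within {0..T})" if "g \<in> S" "t \<in> {0..T}" for g t
    using assms(4)[OF that(1)] that(2) differentiableI_vector by blast
  ultimately show ?thesis
    using assms(1,2,3) unfolding flat_space_def by blast
qed

lemma flat_zero: "f \<in> \<M> \<Longrightarrow> f 0 = 0"
  unfolding flat_space_def by (metis (mono_tags, lifting) funpow_0 mem_Collect_eq)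

lemma flat_outside: "f \<in> \<M> \<Longrightarrow> t \<notin> {0..T} \<Longrightarrow> f t = 0"
  unfolding flat_space_def by blast

lemma flat_deriv:
  assumes "f \<in> \<M>"
  shows "\<delta> f \<in> \<M>"
proof -
  have "(\<delta> ^^ n) (\<delta> f) = (\<delta> ^^ Suc n) f" for n
    by (simp add: funpow_swap1)
  then show ?thesis
    using assms unfolding flat_space_def by (auto simp: deriv_on_def simp del: funpow.simps)
qed

lemma flat_has_derivative:
  assumes "f \<in> \<M>" "t \<in> {0..T}"
  shows "(f has_vector_derivative \<delta> f t) (at t within {0..T})"
proof -
  have "f differentiable (at t within {0..T})"
    using assms unfolding flat_space_def by (metis (mono_tags, lifting) funpow_0 mem_Collect_eq)
  then show ?thesis
    using assms(2) by (simp add: deriv_on_def vector_derivative_works)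
qed

lemma flat_continuous: "f \<in> \<M> \<Longrightarrow> continuous_on {0..T} f"
  unfolding continuous_on_eq_continuous_within
  using flat_has_derivative has_vector_derivative_continuous by blast

lemma continuous_bounded_functions:
  assumes "continuous_on {0..T} f" "\<And>t. t \<notin> {0..T} \<Longrightarrow> f t = 0"
  shows "f \<in> bounded_functions T"
proof -
  have "f = (\<lambda>x. indicator {0..T} x *\<^sub>R f x)"
    using assms(2) by (auto simp: indicator_def)
  moreover have "(\<lambda>x. indicator {0..T} x *\<^sub>R f x) \<in> borel_measurable borel"
    by (rule borel_measurable_continuous_on_indicator) (use assms in auto)
  ultimately have "f \<in> borel_measurable borel" by simp
  moreover have "range f \<subseteq> insert 0 (f ` {0..T})"
    using assms(2) by blast
  moreover have "bounded (insert 0 (f ` {0..T}))"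
    using compact_continuous_image[OF assms(1)] compact_imp_bounded by auto
  ultimately show ?thesis
    using assms(2) bounded_subset unfolding bounded_functions_def by blast
qed

lemma flat_bounded: "f \<in> \<M> \<Longrightarrow> f \<in> bounded_functions T"
  using continuous_bounded_functions flat_continuous flat_outside by blast

lemma flat_kernel: "f \<in> \<M> \<Longrightarrow> f \<in> integrable_kernels T"
  using flat_bounded bounded_functions_integrable_kernels by blast

lemma flat_0: "(\<lambda>t. 0) \<in> \<M>"
  by (rule flat_coinduct[where S="{\<lambda>t. 0}"]) auto

lemma flat_add:
  assumes "f \<in> \<M>" "g \<in> \<M>"
  shows "(\<lambda>t. f t + g t) \<in> \<M>"
proof (rule flat_coinduct[where S="{\<lambda>t. f t + g t |f g. f \<in> \<M> \<and> g \<in> \<M>}"], goal_cases)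
  case (4 h)
  then obtain f g where fg: "f \<in> \<M>" "g \<in> \<M>" "h = (\<lambda>t. f t + g t)" by auto
  show ?case
    by (rule bexI[of _ "\<lambda>t. \<delta> f t + \<delta> g t"])
       (use fg flat_deriv flat_has_derivative in
        \<open>auto intro!: has_vector_derivative_add\<close>)
qed (use assms in \<open>auto simp: flat_zero flat_outside\<close>)

lemma flat_scale:
  assumes "f \<in> \<M>"
  shows "(\<lambda>t. c * f t) \<in> \<M>"
proof (rule flat_coinduct[where S="{\<lambda>t. c * f t |f. f \<in> \<M>}"], goal_cases)
  case (4 h)
  then obtain f where fg: "f \<in> \<M>" "h = (\<lambda>t. c * f t)" by auto
  show ?case
    by (rule bexI[of _ "\<lambda>t. c * \<delta> f t"])
       (use fg flat_deriv flat_has_derivative in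
        \<open>auto intro!: has_vector_derivative_mult_right\<close>)
qed (use assms in \<open>auto simp: flat_zero flat_outside\<close>)

lemma deriv_on_add:
  assumes "f \<in> \<M>" "g \<in> \<M>"
  shows "\<delta> (\<lambda>t. f t + g t) = (\<lambda>t. \<delta> f t + \<delta> g t)"
  by (rule deriv_on_eqI)
     (use assms flat_has_derivative in
       \<open>auto intro!: has_vector_derivative_add simp: deriv_on_def\<close>)

lemma deriv_on_scale:
  assumes "f \<in> \<M>"
  shows "\<delta> (\<lambda>t. c * f t) = (\<lambda>t. c * \<delta> f t)"
  by (rule deriv_on_eqI)
     (use assms flat_has_derivative in
       \<open>auto intro!: has_vector_derivative_mult_right simp: deriv_on_def\<close>)

lemma has_derivative_times:
  assumes "f \<in> \<M>" "t \<in> {0..T}"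
  shows "((\<lambda>t. of_real t * f t) has_vector_derivative f t + of_real t * \<delta> f t)
     (at t within {0..T})"
proof -
  have "((\<lambda>t. complex_of_real t) has_vector_derivative 1) (at t within {0..T})"
    using has_vector_derivative_of_real[of "\<lambda>t. t" 1] has_real_derivative_iff_has_vector_derivative
    by (metis DERIV_ident of_real_1)
  from has_vector_derivative_mult[OF this flat_has_derivative[OF assms]]
  show ?thesis by (simp add: add.commute)
qed

lemma deriv_on_times:
  assumes "f \<in> \<M>"
  shows "\<delta> (\<lambda>t. of_real t * f t) = (\<lambda>t. f t + of_real t * \<delta> f t)"
  by (rule deriv_on_eqI) (use assms has_derivative_times flat_outside in
     \<open>auto simp: deriv_on_def\<close>)

text \<open>
  The functions \<open>t f(t)\<close> are not stable under differentiation, since \<open>(t f)' = t f' + f\<close>; the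
  functions \<open>t f(t) + g(t)\<close> with \<open>f\<close> and \<open>g\<close> flat are.
\<close>

lemma flat_times:
  assumes "f \<in> \<M>"
  shows "(\<lambda>t. of_real t * f t) \<in> \<M>"
proof (rule flat_coinduct[where S="{\<lambda>t. of_real t * f t + g t |f g. f \<in> \<M> \<and> g \<in> \<M>}"], goal_cases)
  case 1
  show ?case using assms flat_0 by force
next
  case (4 h)
  then obtain f g where fg: "f \<in> \<M>" "g \<in> \<M>" "h = (\<lambda>t. of_real t * f t + g t)" by auto
  let ?h' = "\<lambda>t. of_real t * \<delta> f t + (f t + \<delta> g t)"
  have "?h' \<in> {\<lambda>t. of_real t * f t + g t |f g. f \<in> \<M> \<and> g \<in> \<M>}"
  proof (intro CollectI exI conjI)
    show "\<delta> f \<in> \<M>" "(\<lambda>t. f t + \<delta> g t) \<in> \<M>"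
      using fg flat_deriv flat_add by auto
  qed simp
  moreover have "(h has_vector_derivative ?h' t) (at t within {0..T})" if "t \<in> {0..T}" for t
    using has_vector_derivative_add[OF has_derivative_times[OF fg(1) that]
        flat_has_derivative[OF fg(2) that]]
    unfolding fg by (simp add: algebra_simps)
  ultimately show ?case by (intro bexI[of _ ?h'] ballI)
qed (auto simp: flat_zero flat_outside)

definition unit_step :: "real \<Rightarrow> complex" where
  "unit_step = (\<lambda>s. if s \<in> {0..T} then 1 else 0)"

lemma unit_step_kernel: "unit_step \<in> integrable_kernels T"
  by (intro bounded_functions_integrable_kernels continuous_bounded_functions)
     (auto simp: unit_step_def intro: continuous_on_eq[OF continuous_on_const[of _ 1]])

lemma conv_unit_step:
  assumes "f \<in> bounded_functions T" "t \<in> {0..T}"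
  shows "conv T unit_step f t = integral {0..t} f"
  unfolding conv_eq_integral[OF unit_step_kernel assms]
  by (rule Henstock_Kurzweil_Integration.integral_cong) (use assms in \<open>auto simp: unit_step_def\<close>)

lemma flat_eq_conv_deriv:
  assumes "f \<in> \<M>"
  shows "f = conv T unit_step (\<delta> f)"
proof (rule ext)
  fix t
  show "f t = conv T unit_step (\<delta> f) t"
  proof (cases "t \<in> {0..T}")
    case True
    have "(\<delta> f has_integral (f t - f 0)) {0..t}"
    proof (rule fundamental_theorem_of_calculus)
      fix x assume "x \<in> {0..t}"
      with True show "(f has_vector_derivative \<delta> f x) (at x within {0..t})"
        by (intro has_vector_derivative_within_subset[OF flat_has_derivative[OF assms, of x]]) auto
    qed (use True in auto)
    then show ?thesis
      using conv_unit_step[OF flat_bounded[OF flat_deriv[OF assms]] True] flat_zero[OF assms]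
      by (simp add: integral_unique)
  next
    case False
    then show ?thesis by (metis flat_outside[OF assms] conv_outside)
  qed
qed

text \<open>
  With \<open>1\<close> for the unit step, \<open>w * f = w * (1 * f') = 1 * (w * f')\<close>. This is the source of all
  regularity of convolutions with merely integrable kernels.
\<close>

lemma conv_eq_integral_conv_deriv:
  assumes "w \<in> integrable_kernels T" "f \<in> \<M>" "t \<in> {0..T}"
  shows "conv T w f t = integral {0..t} (conv T w (\<delta> f))"
proof -
  have b: "\<delta> f \<in> bounded_functions T" using assms flat_deriv flat_bounded by blast
  have "conv T w f = conv T w (conv T unit_step (\<delta> f))"
    using flat_eq_conv_deriv[OF assms(2)] by simp
  also have "\<dots> = conv T unit_step (conv T w (\<delta> f))"
    by (rule conv_left_commute[OF assms(1) unit_step_kernel b])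
  finally show ?thesis
    using conv_unit_step[OF conv_bounded_functions[OF assms(1) b] assms(3)] by simp
qed

text \<open>
  An indefinite integral of the bounded function \<open>w * f'\<close> is continuous. Applied to \<open>f'\<close> in place
  of \<open>f\<close>, this makes the integrand itself continuous, and \<open>w * f\<close> is differentiable by the
  fundamental theorem of calculus.
\<close>

lemma conv_continuous:
  assumes "w \<in> integrable_kernels T" "f \<in> \<M>"
  shows "continuous_on {0..T} (conv T w f)"
proof -
  have "conv T w (\<delta> f) \<in> bounded_functions T"
    using assms flat_deriv flat_bounded conv_bounded_functions by blast
  then have "integrable lborel (conv T w (\<delta> f))"
    using bounded_functions_integrable_kernels by (auto simp: integrable_kernels_def)
  then have "conv T w (\<delta> f) integrable_on UNIV"
    by (rule integrable_on_lborel)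
  then have "conv T w (\<delta> f) integrable_on {0..T}"
    using integrable_on_subinterval by blast
  from indefinite_integral_continuous_1[OF this] show ?thesis
    by (rule continuous_on_eq) (use conv_eq_integral_conv_deriv[OF assms] in auto)
qed

lemma conv_has_derivative:
  assumes "w \<in> integrable_kernels T" "f \<in> \<M>" "t \<in> {0..T}"
  shows "(conv T w f has_vector_derivative conv T w (\<delta> f) t) (at t within {0..T})"
proof (rule has_vector_derivative_transform[OF assms(3)])
  show "((\<lambda>u. integral {0..u} (conv T w (\<delta> f))) has_vector_derivative conv T w (\<delta> f) t)
     (at t within {0..T})"
    by (rule integral_has_vector_derivative)
       (use assms flat_deriv conv_continuous in auto)
qed (use conv_eq_integral_conv_deriv[OF assms(1,2)] in auto)

lemma deriv_on_conv:
  assumes "w \<in> integrable_kernels T" "f \<in> \<M>"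
  shows "\<delta> (conv T w f) = conv T w (\<delta> f)"
  by (rule deriv_on_eqI) (use assms conv_has_derivative in \<open>auto simp: conv_def\<close>)

lemma conv_flat:
  assumes "w \<in> integrable_kernels T" "f \<in> \<M>"
  shows "conv T w f \<in> \<M>"
proof (rule flat_coinduct[where S="{conv T w f |f. f \<in> \<M>}"], goal_cases)
  case (2 g)
  then show ?case
    using T_pos by (auto simp: conv_eq_integral_conv_deriv[OF assms(1)])
next
  case (4 g)
  then obtain f where f: "f \<in> \<M>" "g = conv T w f" by auto
  show ?case
    by (rule bexI[of _ "conv T w (\<delta> f)"])
       (use f flat_deriv conv_has_derivative[OF assms(1)] in auto)
qed (use assms in \<open>auto simp: conv_def\<close>)

lemma kernel_times:
  assumes "w \<in> integrable_kernels T"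
  shows "(\<lambda>s. of_real s * w s) \<in> integrable_kernels T"
proof -
  have [measurable]: "w \<in> borel_measurable borel"
    using assms integrable_kernels_measurable by auto
  have "integrable lborel (\<lambda>s. T * norm (w s))"
    using assms by (auto simp: integrable_kernels_def)
  then have "integrable lborel (\<lambda>s. of_real s * w s)"
  proof (rule Bochner_Integration.integrable_bound)
    show "AE s in lborel. norm (of_real s * w s) \<le> norm (T * norm (w s))"
    proof (rule AE_I2)
      fix s
      show "norm (of_real s * w s) \<le> norm (T * norm (w s))"
        by (cases "s \<in> {0..T}")
           (use assms T_pos in \<open>auto simp: integrable_kernels_def norm_mult intro!: mult_right_mono\<close>)
    qed
  qed auto
  then show ?thesis using assms by (auto simp: integrable_kernels_def)
qed

text \<open>
  The integrand on the left contains the factor \<open>t - s\<close>, whose two terms give the two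
  convolutions on the right.
\<close>

lemma conv_times:
  assumes "w \<in> integrable_kernels T" "f \<in> bounded_functions T"
  shows "conv T w (\<lambda>t. of_real t * f t) =
    (\<lambda>t. of_real t * conv T w f t - conv T (\<lambda>s. of_real s * w s) f t)"
proof -
  have "(LINT s|lborel. w s * (of_real (t - s) * f (t - s))) =
     of_real t * (LINT s|lborel. w s * f (t - s)) - (LINT s|lborel. of_real s * w s * f (t - s))" for t
  proof -
    have "(LINT s|lborel. w s * (of_real (t - s) * f (t - s))) =
      (LINT s|lborel. of_real t * (w s * f (t - s)) - of_real s * w s * f (t - s))"
      by (simp add: algebra_simps)
    then show ?thesis
      using conv_integrand_integrable[OF assms(1,2), of t]
        conv_integrand_integrable[OF kernel_times[OF assms(1)] assms(2), of t]
      by simp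
  qed
  then show ?thesis by (auto simp: conv_def)
qed

section \<open>Fractional integration as a convolution\<close>

definition power_kernel :: "real \<Rightarrow> real \<Rightarrow> complex" where
  "power_kernel \<mu> = (\<lambda>s. if s \<in> {0..T} then of_real (s powr (\<mu> - 1) / Gamma \<mu>) else 0)"

lemma power_kernel_integrable:
  assumes "\<mu> > 0"
  shows "power_kernel \<mu> \<in> integrable_kernels T"
proof -
  have "(\<lambda>s. s powr (\<mu> - 1)) absolutely_integrable_on {0..T}"
    by (intro nonnegative_absolutely_integrable_1 integrable_on_powr_from_0)
       (use assms T_pos in auto)
  then have "integrable lebesgue (\<lambda>s::real. indicator {0..T} s *\<^sub>R s powr (\<mu> - 1))"
    by (simp add: set_integrable_def)
  then have "integrable lborel (\<lambda>s::real. indicator {0..T} s *\<^sub>R s powr (\<mu> - 1))"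
    by (subst (asm) integrable_completion) auto
  then have "integrable lborel
     (\<lambda>s. complex_of_real (indicator {0..T} s *\<^sub>R s powr (\<mu> - 1)) / of_real (Gamma \<mu>))"
    by (intro integrable_divide integrable_of_real)
  moreover have "power_kernel \<mu> =
     (\<lambda>s. complex_of_real (indicator {0..T} s *\<^sub>R s powr (\<mu> - 1)) / of_real (Gamma \<mu>))"
    by (auto simp: power_kernel_def indicator_def)
  ultimately show ?thesis
    by (auto simp: integrable_kernels_def power_kernel_def)
qed

lemma frac_int_eq_conv:
  assumes "\<mu> > 0" "f \<in> \<M>"
  shows "frac_int T \<mu> f = conv T (power_kernel \<mu>) f"
proof (rule ext)
  fix t
  show "frac_int T \<mu> f t = conv T (power_kernel \<mu>) f t"
  proof (cases "t \<in> {0..T}")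
    case True
    have "conv T (power_kernel \<mu>) f t = integral {0..t} (\<lambda>s. power_kernel \<mu> (t - s) * f s)"
      by (rule conv_eq_integral[OF power_kernel_integrable[OF assms(1)] flat_bounded[OF assms(2)] True])
    also have "\<dots> = integral {0..t} (\<lambda>s. (1 / Gamma \<mu>) *\<^sub>R (((t - s) powr (\<mu> - 1)) *\<^sub>R f s))"
      by (rule Henstock_Kurzweil_Integration.integral_cong)
         (use True in \<open>auto simp: power_kernel_def scaleR_conv_of_real\<close>)
    also have "\<dots> = (1 / Gamma \<mu>) *\<^sub>R integral {0..t} (\<lambda>s. ((t - s) powr (\<mu> - 1)) *\<^sub>R f s)"
      by (rule integral_cmul)
    finally show ?thesis using True by (simp add: frac_int_def)
  next
    case False
    then show ?thesis unfolding conv_outside[OF False] frac_int_def by (rule if_not_P)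
  qed
qed

section \<open>The ring of linear operators on flat functions\<close>

abbreviation (input) \<E> where "\<E> \<equiv> End_flat T"

lemma End_mult_apply: "f \<in> \<M> \<Longrightarrow> (L \<otimes>\<^bsub>\<E>\<^esub> L') f = L (L' f)"
  by (simp add: End_flat_def compose_def)

lemma End_add_apply: "f \<in> \<M> \<Longrightarrow> (L \<oplus>\<^bsub>\<E>\<^esub> L') f = (\<lambda>t. L f t + L' f t)"
  by (simp add: End_flat_def)

lemma End_one_apply: "f \<in> \<M> \<Longrightarrow> \<one>\<^bsub>\<E>\<^esub> f = f"
  by (simp add: End_flat_def)

lemma End_zero_apply: "f \<in> \<M> \<Longrightarrow> \<zero>\<^bsub>\<E>\<^esub> f = (\<lambda>t. 0)"
  by (simp add: End_flat_def)

lemmas End_apply = End_mult_apply End_add_apply End_one_apply End_zero_apply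

lemma End_app_flat: "L \<in> carrier \<E> \<Longrightarrow> f \<in> \<M> \<Longrightarrow> L f \<in> \<M>"
  by (auto simp: End_flat_def)

lemma End_app_add:
  "L \<in> carrier \<E> \<Longrightarrow> f \<in> \<M> \<Longrightarrow> g \<in> \<M> \<Longrightarrow> L (\<lambda>t. f t + g t) = (\<lambda>t. L f t + L g t)"
  by (auto simp: End_flat_def)

lemma End_app_scale:
  "L \<in> carrier \<E> \<Longrightarrow> f \<in> \<M> \<Longrightarrow> L (\<lambda>t. c * f t) = (\<lambda>t. c * L f t)"
  by (auto simp: End_flat_def)

lemma End_restrictI:
  assumes "\<And>f. f \<in> \<M> \<Longrightarrow> F f \<in> \<M>"
    and "\<And>f g. f \<in> \<M> \<Longrightarrow> g \<in> \<M> \<Longrightarrow> F (\<lambda>t. f t + g t) = (\<lambda>t. F f t + F g t)"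
    and "\<And>c f. f \<in> \<M> \<Longrightarrow> F (\<lambda>t. c * f t) = (\<lambda>t. c * F f t)"
  shows "(\<lambda>f\<in>\<M>. F f) \<in> carrier \<E>"
  using assms by (auto simp: End_flat_def flat_add flat_scale)

lemma End_eqI:
  assumes "L \<in> carrier \<E>" "L' \<in> carrier \<E>" "\<And>f. f \<in> \<M> \<Longrightarrow> L f = L' f"
  shows "L = L'"
  using assms by (intro extensionalityI[of L \<M> L']) (auto simp: End_flat_def PiE_def)

lemma End_mult_closed:
  assumes "L \<in> carrier \<E>" "L' \<in> carrier \<E>"
  shows "L \<otimes>\<^bsub>\<E>\<^esub> L' \<in> carrier \<E>"
proof -
  have "L \<otimes>\<^bsub>\<E>\<^esub> L' = (\<lambda>f\<in>\<M>. L (L' f))"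
    by (simp add: End_flat_def compose_def)
  also have "\<dots> \<in> carrier \<E>"
    by (rule End_restrictI) (use assms in \<open>simp_all add: End_app_flat End_app_add End_app_scale\<close>)
  finally show ?thesis .
qed

lemma End_add_closed:
  assumes "L \<in> carrier \<E>" "L' \<in> carrier \<E>"
  shows "L \<oplus>\<^bsub>\<E>\<^esub> L' \<in> carrier \<E>"
proof -
  have "L \<oplus>\<^bsub>\<E>\<^esub> L' = (\<lambda>f\<in>\<M>. \<lambda>t. L f t + L' f t)"
    by (simp add: End_flat_def)
  also have "\<dots> \<in> carrier \<E>"
    by (rule End_restrictI)
       (use assms in \<open>simp_all add: End_app_flat End_app_add End_app_scale flat_add algebra_simps\<close>)
  finally show ?thesis .
qed

lemma End_one_closed: "\<one>\<^bsub>\<E>\<^esub> \<in> carrier \<E>"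
  using End_restrictI[of "\<lambda>f. f"] by (simp add: End_flat_def)

lemma scalar_op_closed: "scalar_op T c \<in> carrier \<E>"
  unfolding scalar_op_def by (rule End_restrictI) (simp_all add: flat_scale algebra_simps)

lemma scalar_op_apply: "f \<in> \<M> \<Longrightarrow> scalar_op T c f = (\<lambda>t. c * f t)"
  by (simp add: scalar_op_def)

lemma End_zero_closed: "\<zero>\<^bsub>\<E>\<^esub> \<in> carrier \<E>"
  using scalar_op_closed[of 0] by (simp add: End_flat_def scalar_op_def)

lemmas End_closed = End_mult_closed End_add_closed End_one_closed End_zero_closed scalar_op_closed

lemma End_ring: "ring \<E>"
proof (rule ringI)
  show "abelian_group \<E>"
  proof (rule abelian_groupI)
    fix L assume "L \<in> carrier \<E>"
    then show "\<exists>L'\<in>carrier \<E>. L' \<oplus>\<^bsub>\<E>\<^esub> L = \<zero>\<^bsub>\<E>\<^esub>"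
      by (intro bexI[of _ "scalar_op T (-1) \<otimes>\<^bsub>\<E>\<^esub> L"] End_eqI)
         (simp_all add: End_closed End_apply End_app_flat scalar_op_apply)
  qed (auto intro!: End_eqI simp: End_closed End_apply algebra_simps)
  show "monoid \<E>"
    by (rule monoidI) (auto intro!: End_eqI simp: End_closed End_apply End_app_flat)
qed (auto intro!: End_eqI simp: End_closed End_apply End_app_flat End_app_add)

sublocale End: ring \<E>
  by (rule End_ring)

lemma End_minus:
  assumes "L \<in> carrier \<E>"
  shows "\<ominus>\<^bsub>\<E>\<^esub> L = scalar_op T (-1) \<otimes>\<^bsub>\<E>\<^esub> L"
  by (rule End.minus_equality)
     (use assms in \<open>auto intro!: End_eqI simp: End_closed End_apply End_app_flat scalar_op_apply\<close>)

section \<open>Coordinate, derivative and convolution operators\<close>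

definition coordinate_op where "coordinate_op = mult_op T [:0, 1:]"
definition derivative_op where "derivative_op = (\<lambda>f\<in>\<M>. \<delta> f)"
definition kernel_op where "kernel_op w = (\<lambda>f\<in>\<M>. conv T w f)"

lemma coordinate_op_apply: "f \<in> \<M> \<Longrightarrow> coordinate_op f = (\<lambda>t. of_real t * f t)"
  by (simp add: coordinate_op_def mult_op_def)

lemma derivative_op_apply: "f \<in> \<M> \<Longrightarrow> derivative_op f = \<delta> f"
  by (simp add: derivative_op_def)

lemma kernel_op_apply: "f \<in> \<M> \<Longrightarrow> kernel_op w f = conv T w f"
  by (simp add: kernel_op_def)

lemma coordinate_op_closed: "coordinate_op \<in> carrier \<E>"
proof -
  have "coordinate_op = (\<lambda>f\<in>\<M>. \<lambda>t. of_real t * f t)"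
    by (simp add: coordinate_op_def mult_op_def)
  also have "\<dots> \<in> carrier \<E>"
    by (rule End_restrictI) (simp_all add: flat_times distrib_left mult.left_commute)
  finally show ?thesis .
qed

lemma derivative_op_closed: "derivative_op \<in> carrier \<E>"
  unfolding derivative_op_def by (rule End_restrictI) (simp_all add: flat_deriv deriv_on_add deriv_on_scale)

lemma kernel_op_closed: "w \<in> integrable_kernels T \<Longrightarrow> kernel_op w \<in> carrier \<E>"
  unfolding kernel_op_def
  by (rule End_restrictI) (simp_all add: conv_flat conv_add_right flat_bounded conv_scale_right)

lemma conv_op_eq_kernel_op:
  assumes "k \<in> \<M>"
  shows "conv_op T k = kernel_op k"
  unfolding conv_op_def volterra_op_def kernel_op_def
  using conv_eq_integral[OF flat_kernel[OF assms] flat_bounded]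
  by (intro restrict_ext ext) (auto simp: conv_outside)

lemma mult_op_0: "mult_op T 0 = \<zero>\<^bsub>\<E>\<^esub>"
  by (simp add: mult_op_def End_flat_def)

text \<open>
  Horner's rule writes multiplication by a polynomial in terms of scalars and the coordinate.
  It is proved together with the invariance of the flat functions under polynomials, because
  each step evaluates the coordinate operator at a function that must already be known to be
  flat.
\<close>

lemma mult_op_closed_pCons:
  "mult_op T p \<in> carrier \<E> \<and>
    mult_op T (pCons a p) = scalar_op T a \<oplus>\<^bsub>\<E>\<^esub> coordinate_op \<otimes>\<^bsub>\<E>\<^esub> mult_op T p"
proof (induction p arbitrary: a)
  case 0
  have "mult_op T [:a:] = scalar_op T a" by (simp add: mult_op_def scalar_op_def)
  then show ?case
    by (simp add: mult_op_0 End_closed coordinate_op_closed)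
next
  case (pCons b q)
  have closed: "mult_op T (pCons b q) \<in> carrier \<E>"
    using pCons.IH[of b] by (simp add: End_closed coordinate_op_closed)
  have "mult_op T (pCons a (pCons b q)) = (\<lambda>f\<in>\<M>. \<lambda>t. a * f t + of_real t * mult_op T (pCons b q) f t)"
    by (auto simp: mult_op_def algebra_simps fun_eq_iff)
  also have "\<dots> = scalar_op T a \<oplus>\<^bsub>\<E>\<^esub> coordinate_op \<otimes>\<^bsub>\<E>\<^esub> mult_op T (pCons b q)"
    using End_app_flat[OF closed]
    by (auto simp: End_flat_def compose_def coordinate_op_apply scalar_op_apply intro!: restrict_ext)
  finally show ?case using closed by blast
qed

lemmas mult_op_closed = mult_op_closed_pCons[THEN conjunct1]
lemmas mult_op_pCons = mult_op_closed_pCons[THEN conjunct2]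

section \<open>Flat Volterra operators\<close>

text \<open>
  An inductive description of the flat Volterra operators, which turns statements about finite
  sums of kernels \<open>p(t) k(t - s)\<close> into inductions: \<open>times\<close> builds the polynomial factors one
  degree at a time.
\<close>

inductive_set flat_span :: "((real \<Rightarrow> complex) \<Rightarrow> (real \<Rightarrow> complex)) set" where
  conv: "k \<in> \<M> \<Longrightarrow> kernel_op k \<in> flat_span"
| add: "L \<in> flat_span \<Longrightarrow> L' \<in> flat_span \<Longrightarrow> L \<oplus>\<^bsub>\<E>\<^esub> L' \<in> flat_span"
| times: "L \<in> flat_span \<Longrightarrow> coordinate_op \<otimes>\<^bsub>\<E>\<^esub> L \<in> flat_span"

lemma flat_span_closed: "L \<in> flat_span \<Longrightarrow> L \<in> carrier \<E>"
  by (induction rule: flat_span.induct) (auto simp: End_closed coordinate_op_closed kernel_op_closed flat_kernel)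

lemma flat_span_zero: "\<zero>\<^bsub>\<E>\<^esub> \<in> flat_span"
proof -
  have "kernel_op (\<lambda>t. 0) = \<zero>\<^bsub>\<E>\<^esub>"
    by (auto simp: kernel_op_def End_flat_def conv_def fun_eq_iff)
  then show ?thesis using flat_span.conv[OF flat_0] by simp
qed

lemma flat_span_scale: "L \<in> flat_span \<Longrightarrow> scalar_op T c \<otimes>\<^bsub>\<E>\<^esub> L \<in> flat_span"
proof (induction rule: flat_span.induct)
  case (conv k)
  have "scalar_op T c \<otimes>\<^bsub>\<E>\<^esub> kernel_op k = kernel_op (\<lambda>t. c * k t)"
    by (rule End_eqI)
       (use conv in \<open>simp_all add: End_closed kernel_op_closed flat_kernel flat_scale End_apply kernel_op_apply
          scalar_op_apply conv_flat conv_scale_left\<close>)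
  then show ?case using flat_span.conv[OF flat_scale[OF conv]] by simp
next
  case (add L L')
  then show ?case
    by (simp add: End.r_distr flat_span_closed End_closed flat_span.add)
next
  case (times L)
  have "scalar_op T c \<otimes>\<^bsub>\<E>\<^esub> (coordinate_op \<otimes>\<^bsub>\<E>\<^esub> L) = coordinate_op \<otimes>\<^bsub>\<E>\<^esub> (scalar_op T c \<otimes>\<^bsub>\<E>\<^esub> L)"
    by (rule End_eqI)
       (use flat_span_closed[OF times(1)] in
        \<open>simp_all add: End_closed coordinate_op_closed End_apply End_app_flat scalar_op_apply coordinate_op_apply
          flat_times flat_scale algebra_simps\<close>)
  then show ?case using flat_span.times[OF times(2)] by simp
qed

lemma flat_span_subgroup: "subgroup flat_span (add_monoid \<E>)"
proof (rule End.add.subgroupI)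
  fix L assume "L \<in> flat_span"
  then have "scalar_op T (-1) \<otimes>\<^bsub>\<E>\<^esub> L \<in> flat_span" by (rule flat_span_scale)
  then show "\<ominus>\<^bsub>\<E>\<^esub> L \<in> flat_span"
    using End_minus[OF flat_span_closed[OF \<open>L \<in> flat_span\<close>]] by simp
qed (use flat_span_closed flat_span_zero flat_span.add in auto)

lemma flat_span_mult_op:
  assumes "L \<in> flat_span"
  shows "mult_op T p \<otimes>\<^bsub>\<E>\<^esub> L \<in> flat_span"
proof (induction p)
  case 0
  then show ?case by (simp add: mult_op_0 flat_span_closed assms flat_span_zero)
next
  case (pCons a p)
  then show ?case
    by (simp add: mult_op_pCons End.l_distr End.m_assoc End_closed coordinate_op_closed mult_op_closed
        flat_span_closed assms flat_span.add flat_span.times flat_span_scale)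
qed

text \<open>
  The action of a flat kernel in terms of convolutions: the polynomials depend on \<open>t\<close> only and
  come out of the integral over \<open>s\<close>.
\<close>

definition poly_conv_op ::
  "nat \<Rightarrow> (nat \<Rightarrow> complex poly) \<Rightarrow> (nat \<Rightarrow> real \<Rightarrow> complex) \<Rightarrow> (real \<Rightarrow> complex) \<Rightarrow> real \<Rightarrow> complex" where
  "poly_conv_op N p k = (\<lambda>f\<in>\<M>. \<lambda>t. \<Sum>r=1..N. poly (p r) (of_real t) * conv T (k r) f t)"

lemma volterra_op_eq_poly_conv_op:
  assumes "\<And>r. r \<in> {1..N} \<Longrightarrow> k r \<in> \<M>"
    and "\<And>t s. 0 \<le> s \<Longrightarrow> s \<le> t \<Longrightarrow> t \<le> T \<Longrightarrow> K t s = (\<Sum>r=1..N. poly (p r) (of_real t) * k r (t - s))"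
  shows "volterra_op T K = poly_conv_op N p k"
  unfolding volterra_op_def poly_conv_op_def
proof (intro restrict_ext ext)
  fix f t
  assume f: "f \<in> \<M>"
  show "(if t \<in> {0..T} then integral {0..t} (\<lambda>s. K t s * f s) else 0) =
      (\<Sum>r=1..N. poly (p r) (of_real t) * conv T (k r) f t)"
  proof (cases "t \<in> {0..T}")
    case False
    then show ?thesis
      unfolding if_not_P[OF False]
      by (simp only: conv_outside mult_zero_right sum.neutral_const not_False_eq_True)
  next
    case True
    have int: "(\<lambda>s. k r (t - s) * f s) integrable_on {0..t}" if "r \<in> {1..N}" for r
      by (intro integrable_continuous_real continuous_intros
          continuous_on_compose2[OF flat_continuous[OF assms(1)[OF that]]]
          continuous_on_subset[OF flat_continuous[OF f]]) (use True in auto)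
    have "integral {0..t} (\<lambda>s. K t s * f s) =
      integral {0..t} (\<lambda>s. \<Sum>r=1..N. poly (p r) (of_real t) * (k r (t - s) * f s))"
      by (rule Henstock_Kurzweil_Integration.integral_cong)
         (use True assms(2) in \<open>auto simp: sum_distrib_right mult.assoc\<close>)
    also have "\<dots> = (\<Sum>r=1..N. integral {0..t} (\<lambda>s. poly (p r) (of_real t) * (k r (t - s) * f s)))"
      by (rule Henstock_Kurzweil_Integration.integral_sum)
         (use int in \<open>auto intro!: integrable_on_mult_right\<close>)
    also have "\<dots> = (\<Sum>r=1..N. poly (p r) (of_real t) * conv T (k r) f t)"
      by (rule sum.cong)
         (use conv_eq_integral[OF flat_kernel flat_bounded[OF f] True] assms(1) in auto)
    finally show ?thesis using True by simp
  qed
qed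

lemma flat_volterra_eq:
  "flat_volterra T = {poly_conv_op N p k |N p k. \<forall>r\<in>{1..N}. k r \<in> \<M>}" (is "_ = ?R")
proof (intro equalityI subsetI)
  fix L assume "L \<in> flat_volterra T"
  then obtain K p k and N :: nat where L: "L = volterra_op T K" and k: "\<forall>r\<in>{1..N}. k r \<in> \<M>"
    and K: "\<forall>t s. 0 \<le> s \<and> s \<le> t \<and> t \<le> T \<longrightarrow>
      K t s = (\<Sum>r=1..N. poly (p r) (of_real t) * k r (t - s))"
    unfolding flat_volterra_def flat_kernels_def by (elim imageE CollectE exE conjE) (rule that)
  have "L = poly_conv_op N p k"
    unfolding L by (rule volterra_op_eq_poly_conv_op) (use k K in auto)
  then show "L \<in> ?R" using k by blast
next
  fix L assume "L \<in> ?R"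
  then obtain N p k where L: "L = poly_conv_op N p k" and k: "\<forall>r\<in>{1..N}. k r \<in> \<M>"
    by auto
  define K where "K = (\<lambda>t s. \<Sum>r=1..N. poly (p r) (of_real t) * k r (t - s))"
  have "K \<in> flat_kernels T"
    unfolding flat_kernels_def mem_Collect_eq
    by (rule exI[of _ N], rule exI[of _ p], rule exI[of _ k]) (use k in \<open>simp add: K_def\<close>)
  moreover have "L = volterra_op T K"
    unfolding L using volterra_op_eq_poly_conv_op[of N k K p] k by (simp add: K_def)
  ultimately show "L \<in> flat_volterra T" by (simp add: flat_volterra_def)
qed

text \<open>
  From left to right, the terms of a sum are added one by one. From right to left, sums of
  operators are concatenated, and multiplication by the coordinate raises the degree of each
  polynomial.
\<close>

lemma flat_volterra_eq_flat_span: "flat_volterra T = flat_span"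
proof (intro equalityI subsetI)
  fix L assume "L \<in> flat_volterra T"
  then obtain N p k where L: "L = poly_conv_op N p k" and k: "\<forall>r\<in>{1..N}. k r \<in> \<M>"
    unfolding flat_volterra_eq by auto
  have "poly_conv_op N p k \<in> flat_span"
    using k
  proof (induction N)
    case 0
    have "poly_conv_op 0 p k = \<zero>\<^bsub>\<E>\<^esub>"
      by (simp add: poly_conv_op_def End_flat_def)
    then show ?case using flat_span_zero by simp
  next
    case (Suc N)
    have "poly_conv_op (Suc N) p k =
        poly_conv_op N p k \<oplus>\<^bsub>\<E>\<^esub> mult_op T (p (Suc N)) \<otimes>\<^bsub>\<E>\<^esub> kernel_op (k (Suc N))"
      using Suc.prems
      by (auto simp: poly_conv_op_def End_flat_def compose_def fun_eq_iff mult_op_def kernel_op_apply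
          conv_flat flat_kernel)
    then show ?case
      using Suc by (auto intro!: flat_span.add flat_span_mult_op flat_span.conv)
  qed
  then show "L \<in> flat_span" using L by simp
next
  fix L assume "L \<in> flat_span"
  then have "\<exists>N p k. L = poly_conv_op N p k \<and> (\<forall>r\<in>{1..N}. k r \<in> \<M>)"
  proof (induction rule: flat_span.induct)
    case (conv k)
    have "kernel_op k = poly_conv_op 1 (\<lambda>r. 1) (\<lambda>r. k)"
      by (simp add: kernel_op_def poly_conv_op_def)
    then show ?case using conv by (intro exI[of _ 1] exI[of _ "\<lambda>r. 1"] exI[of _ "\<lambda>r. k"]) simp
  next
    case (times L)
    then obtain N p k where L: "L = poly_conv_op N p k" and k: "\<forall>r\<in>{1..N}. k r \<in> \<M>" by auto
    have "coordinate_op \<otimes>\<^bsub>\<E>\<^esub> L = poly_conv_op N (\<lambda>r. pCons 0 (p r)) k"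
    proof (rule ext)
      fix f
      show "(coordinate_op \<otimes>\<^bsub>\<E>\<^esub> L) f = poly_conv_op N (\<lambda>r. pCons 0 (p r)) k f"
      proof (cases "f \<in> \<M>")
        case True
        then have "L f \<in> \<M>" using End_app_flat flat_span_closed times(1) by blast
        then show ?thesis
          using True by (simp add: End_apply coordinate_op_apply L poly_conv_op_def sum_distrib_left mult.assoc)
      qed (simp add: End_flat_def compose_def poly_conv_op_def)
    qed
    then show ?case
      using k by (intro exI[of _ N] exI[of _ "\<lambda>r. pCons 0 (p r)"] exI[of _ k]) simp
  next
    case (add L L')
    then obtain N p k N' p' k' where L: "L = poly_conv_op N p k" "L' = poly_conv_op N' p' k'"
      and k: "\<forall>r\<in>{1..N}. k r \<in> \<M>" "\<forall>r\<in>{1..N'}. k' r \<in> \<M>" by auto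
    define q where "q = (\<lambda>r. if r \<le> N then p r else p' (r - N))"
    define l where "l = (\<lambda>r. if r \<le> N then k r else k' (r - N))"
    have "(\<Sum>r=1..N + N'. poly (q r) (of_real t) * conv T (l r) f t) =
      (\<Sum>r=1..N. poly (p r) (of_real t) * conv T (k r) f t) +
      (\<Sum>r=1..N'. poly (p' r) (of_real t) * conv T (k' r) f t)" for f t
    proof -
      let ?g = "\<lambda>r. poly (q r) (of_real t) * conv T (l r) f t"
      have "(\<Sum>r=1..N + N'. ?g r) = (\<Sum>r=1..N. ?g r) + (\<Sum>r=N+1..N + N'. ?g r)"
        by (rule sum.ub_add_nat) simp
      also have "(\<Sum>r=N+1..N + N'. ?g r) = (\<Sum>r=1..N'. ?g (r + N))"
        using sum.shift_bounds_cl_nat_ivl[of ?g 1 N N'] by (simp add: add.commute)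
      finally show ?thesis by (simp add: q_def l_def)
    qed
    then have "L \<oplus>\<^bsub>\<E>\<^esub> L' = poly_conv_op (N + N') q l"
      unfolding L by (auto simp: End_flat_def poly_conv_op_def)
    moreover have "\<forall>r\<in>{1..N + N'}. l r \<in> \<M>"
    proof
      fix r assume r: "r \<in> {1..N + N'}"
      show "l r \<in> \<M>"
      proof (cases "r \<le> N")
        case True
        then show ?thesis using k(1) r by (simp add: l_def)
      next
        case False
        then have "r - N \<in> {1..N'}" using r by auto
        then show ?thesis using k(2) False by (simp add: l_def)
      qed
    qed
    ultimately show ?case
      by (intro exI[of _ "N + N'"] exI[of _ q] exI[of _ l] conjI)
  qed
  then show "L \<in> flat_volterra T" unfolding flat_volterra_eq by blast
qed

section \<open>Relations between the operators\<close>

text \<open>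
  Both products agree: associativity of convolution gives the first, and the second reduces to
  it because convolutions commute.
\<close>

lemma kernel_op_mult:
  assumes "w \<in> integrable_kernels T" "k \<in> \<M>"
  shows "kernel_op w \<otimes>\<^bsub>\<E>\<^esub> kernel_op k = kernel_op (conv T w k)" "kernel_op k \<otimes>\<^bsub>\<E>\<^esub> kernel_op w = kernel_op (conv T w k)"
proof -
  note simps = assms End_closed kernel_op_closed flat_kernel conv_flat End_apply kernel_op_apply
    conv_assoc flat_bounded
  show "kernel_op w \<otimes>\<^bsub>\<E>\<^esub> kernel_op k = kernel_op (conv T w k)"
    by (rule End_eqI) (simp_all add: simps)
  show "kernel_op k \<otimes>\<^bsub>\<E>\<^esub> kernel_op w = kernel_op (conv T w k)"
    by (rule End_eqI) (simp_all add: simps conv_left_commute[of k T w])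
qed

text \<open>
  Either factor of a convolution of flat functions may take the derivative, by commutativity.
  For \<open>V\<^sub>k \<partial>\<close> this stands in for integration by parts, the boundary terms being zero by flatness.
\<close>

lemma derivative_kernel_op_mult:
  assumes "k \<in> \<M>"
  shows "derivative_op \<otimes>\<^bsub>\<E>\<^esub> kernel_op k = kernel_op (\<delta> k)" "kernel_op k \<otimes>\<^bsub>\<E>\<^esub> derivative_op = kernel_op (\<delta> k)"
proof -
  note simps = assms End_closed kernel_op_closed flat_kernel conv_flat flat_deriv End_apply kernel_op_apply
    derivative_op_apply derivative_op_closed
  have "conv T k (\<delta> f) = conv T (\<delta> k) f" if "f \<in> \<M>" for f
    using that by (metis assms conv_commute deriv_on_conv flat_kernel)
  then show "derivative_op \<otimes>\<^bsub>\<E>\<^esub> kernel_op k = kernel_op (\<delta> k)" "kernel_op k \<otimes>\<^bsub>\<E>\<^esub> derivative_op = kernel_op (\<delta> k)"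
    by (auto intro!: End_eqI simp: simps deriv_on_conv)
qed

lemma kernel_coordinate_op_mult:
  assumes "w \<in> integrable_kernels T"
  shows "kernel_op w \<otimes>\<^bsub>\<E>\<^esub> coordinate_op =
    coordinate_op \<otimes>\<^bsub>\<E>\<^esub> kernel_op w \<oplus>\<^bsub>\<E>\<^esub> scalar_op T (-1) \<otimes>\<^bsub>\<E>\<^esub> kernel_op (\<lambda>s. of_real s * w s)"
  by (rule End_eqI)
     (use assms in \<open>simp_all add: End_closed kernel_op_closed coordinate_op_closed kernel_times End_apply kernel_op_apply
       coordinate_op_apply scalar_op_apply conv_flat flat_times conv_times flat_bounded\<close>)

lemma derivative_coordinate_op_mult: "derivative_op \<otimes>\<^bsub>\<E>\<^esub> coordinate_op = \<one>\<^bsub>\<E>\<^esub> \<oplus>\<^bsub>\<E>\<^esub> coordinate_op \<otimes>\<^bsub>\<E>\<^esub> derivative_op"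
  by (rule End_eqI)
     (simp_all add: End_closed derivative_op_closed coordinate_op_closed End_apply derivative_op_apply coordinate_op_apply
        flat_times flat_deriv deriv_on_times)

section \<open>Absorption\<close>

text \<open>
  Sums and coordinate factors stand to the left of the convolutions, so multiplication on the
  right only ever meets the generators.
\<close>

lemma flat_span_right:
  assumes "A \<in> carrier \<E>" "\<And>k. k \<in> \<M> \<Longrightarrow> kernel_op k \<otimes>\<^bsub>\<E>\<^esub> A \<in> flat_span" "L \<in> flat_span"
  shows "L \<otimes>\<^bsub>\<E>\<^esub> A \<in> flat_span"
  using assms(3)
  by (induction rule: flat_span.induct)
     (simp_all add: assms(1,2) flat_span_closed End.l_distr End.m_assoc coordinate_op_closed
       flat_span.add flat_span.times)

text \<open>
  Moving \<open>V\<^sub>w\<close> past the coordinate costs a term with the kernel \<open>x w(x)\<close>, so the induction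
  hypothesis is needed for every integrable \<open>w\<close>. For the kernel of fractional integration of
  order \<open>\<mu>\<close> the new kernel is \<open>\<mu>\<close> times that of order \<open>\<mu> + 1\<close>.
\<close>

lemma flat_span_left_kernel_op:
  assumes "L \<in> flat_span" "w \<in> integrable_kernels T"
  shows "kernel_op w \<otimes>\<^bsub>\<E>\<^esub> L \<in> flat_span"
  using assms
proof (induction arbitrary: w rule: flat_span.induct)
  case (conv k)
  then show ?case by (simp add: kernel_op_mult flat_span.conv conv_flat)
next
  case (add L L')
  then show ?case by (simp add: End.r_distr flat_span_closed kernel_op_closed flat_span.add)
next
  case (times L)
  note closed = End_closed kernel_op_closed coordinate_op_closed kernel_times[OF times.prems] flat_span_closed[OF times.hyps]
    times.prems
  have "kernel_op w \<otimes>\<^bsub>\<E>\<^esub> (coordinate_op \<otimes>\<^bsub>\<E>\<^esub> L) = (kernel_op w \<otimes>\<^bsub>\<E>\<^esub> coordinate_op) \<otimes>\<^bsub>\<E>\<^esub> L"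
    by (simp add: closed End.m_assoc)
  also have "\<dots> = coordinate_op \<otimes>\<^bsub>\<E>\<^esub> (kernel_op w \<otimes>\<^bsub>\<E>\<^esub> L) \<oplus>\<^bsub>\<E>\<^esub>
      scalar_op T (-1) \<otimes>\<^bsub>\<E>\<^esub> (kernel_op (\<lambda>s. of_real s * w s) \<otimes>\<^bsub>\<E>\<^esub> L)"
    by (simp add: kernel_coordinate_op_mult closed End.m_assoc End.l_distr)
  finally show ?case
    using times.IH times.prems kernel_times
    by (simp add: flat_span.add flat_span.times flat_span_scale)
qed

lemma flat_span_left_derivative_op:
  assumes "L \<in> flat_span"
  shows "derivative_op \<otimes>\<^bsub>\<E>\<^esub> L \<in> flat_span"
  using assms
proof (induction rule: flat_span.induct)
  case (conv k)
  then show ?case by (simp add: derivative_kernel_op_mult flat_span.conv flat_deriv)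
next
  case (add L L')
  then show ?case by (simp add: End.r_distr flat_span_closed derivative_op_closed flat_span.add)
next
  case (times L)
  note closed = End_closed derivative_op_closed coordinate_op_closed flat_span_closed[OF times.hyps]
  have "derivative_op \<otimes>\<^bsub>\<E>\<^esub> (coordinate_op \<otimes>\<^bsub>\<E>\<^esub> L) = (derivative_op \<otimes>\<^bsub>\<E>\<^esub> coordinate_op) \<otimes>\<^bsub>\<E>\<^esub> L"
    by (simp add: closed End.m_assoc)
  also have "\<dots> = L \<oplus>\<^bsub>\<E>\<^esub> coordinate_op \<otimes>\<^bsub>\<E>\<^esub> (derivative_op \<otimes>\<^bsub>\<E>\<^esub> L)"
    by (simp add: derivative_coordinate_op_mult closed End.m_assoc End.l_distr)
  finally show ?case
    using times by (simp add: flat_span.add flat_span.times)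
qed

definition idealizer where
  "idealizer = {A \<in> carrier \<E>. \<forall>L\<in>flat_span. A \<otimes>\<^bsub>\<E>\<^esub> L \<in> flat_span \<and> L \<otimes>\<^bsub>\<E>\<^esub> A \<in> flat_span}"

lemma idealizer_subring: "subring idealizer \<E>"
  unfolding idealizer_def by (rule End.idealizer_subring[OF flat_span_subgroup])

lemma idealizerI:
  assumes "A \<in> carrier \<E>" "\<And>L. L \<in> flat_span \<Longrightarrow> A \<otimes>\<^bsub>\<E>\<^esub> L \<in> flat_span"
    "\<And>k. k \<in> \<M> \<Longrightarrow> kernel_op k \<otimes>\<^bsub>\<E>\<^esub> A \<in> flat_span"
  shows "A \<in> idealizer"
  using assms flat_span_right by (auto simp: idealizer_def)

lemma kernel_op_idealizer: "w \<in> integrable_kernels T \<Longrightarrow> kernel_op w \<in> idealizer"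
  by (rule idealizerI)
     (simp_all add: kernel_op_closed flat_span_left_kernel_op kernel_op_mult flat_span.conv conv_flat)

lemma derivative_op_idealizer: "derivative_op \<in> idealizer"
  by (rule idealizerI)
     (simp_all add: derivative_op_closed flat_span_left_derivative_op derivative_kernel_op_mult flat_span.conv flat_deriv)

lemma scalar_op_idealizer: "scalar_op T c \<in> idealizer"
proof (rule idealizerI)
  fix k assume k: "k \<in> \<M>"
  have "kernel_op k \<otimes>\<^bsub>\<E>\<^esub> scalar_op T c = scalar_op T c \<otimes>\<^bsub>\<E>\<^esub> kernel_op k"
    by (rule End_eqI)
       (use k in \<open>simp_all add: End_closed kernel_op_closed flat_kernel End_apply kernel_op_apply
         scalar_op_apply flat_scale conv_flat conv_scale_right\<close>)
  then show "kernel_op k \<otimes>\<^bsub>\<E>\<^esub> scalar_op T c \<in> flat_span"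
    using flat_span_scale flat_span.conv k by simp
qed (simp_all add: scalar_op_closed flat_span_scale)

lemma coordinate_op_idealizer: "coordinate_op \<in> idealizer"
proof (rule idealizerI)
  fix k assume k: "k \<in> \<M>"
  then show "kernel_op k \<otimes>\<^bsub>\<E>\<^esub> coordinate_op \<in> flat_span"
    by (simp add: kernel_coordinate_op_mult flat_kernel flat_span.add flat_span.times flat_span_scale
        flat_span.conv flat_times)
qed (simp_all add: coordinate_op_closed flat_span.times)

lemma mult_op_idealizer: "mult_op T p \<in> idealizer"
proof (induction p)
  case 0
  then show ?case
    using subringE(2)[OF idealizer_subring] by (simp add: mult_op_0)
next
  case (pCons a p)
  then show ?case
    using subringE(6,7)[OF idealizer_subring] coordinate_op_idealizer scalar_op_idealizer
    by (simp add: mult_op_pCons)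
qed

lemma funpow_deriv_flat: "f \<in> \<M> \<Longrightarrow> (\<delta> ^^ n) f \<in> \<M>"
  by (induction n) (auto simp: flat_deriv)

lemma funpow_deriv_idealizer: "(\<lambda>f\<in>\<M>. (\<delta> ^^ n) f) \<in> idealizer"
proof (induction n)
  case 0
  then show ?case using subringE(3)[OF idealizer_subring] by (simp add: End_flat_def restrict_def)
next
  case (Suc n)
  have "(\<lambda>f\<in>\<M>. (\<delta> ^^ Suc n) f) = derivative_op \<otimes>\<^bsub>\<E>\<^esub> (\<lambda>f\<in>\<M>. (\<delta> ^^ n) f)"
    by (auto simp: End_flat_def compose_def fun_eq_iff derivative_op_apply funpow_deriv_flat)
  then show ?case using subringE(6)[OF idealizer_subring derivative_op_idealizer Suc] by (simp only:)
qed

text \<open>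
  A fractional derivative of positive order is a fractional integration of positive order after
  an integer number of derivatives, so it is a product of elements of the idealizer.
\<close>

lemma frac_op_idealizer: "frac_op T \<gamma> \<in> idealizer"
proof -
  consider "\<gamma> < 0" | "\<gamma> = 0" | "\<gamma> > 0" by linarith
  then show ?thesis
  proof cases
    case 1
    then have "frac_op T \<gamma> = kernel_op (power_kernel (- \<gamma>))"
      unfolding frac_op_def kernel_op_def by (intro restrict_ext) (simp add: frac_deriv_def frac_int_eq_conv)
    then show ?thesis using 1 by (simp add: kernel_op_idealizer power_kernel_integrable)
  next
    case 2
    then have "frac_op T \<gamma> = \<one>\<^bsub>\<E>\<^esub>" by (simp add: frac_op_def frac_deriv_def End_flat_def)
    then show ?thesis using subringE(3)[OF idealizer_subring] by simp
  next
    case 3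
    define n where "n = nat (\<lfloor>\<gamma>\<rfloor> + 1)"
    have n: "real n - \<gamma> > 0" unfolding n_def using 3 by linarith
    have "frac_op T \<gamma> = kernel_op (power_kernel (real n - \<gamma>)) \<otimes>\<^bsub>\<E>\<^esub> (\<lambda>f\<in>\<M>. (\<delta> ^^ n) f)"
      using 3 n by (auto simp: frac_op_def frac_deriv_def Let_def End_flat_def compose_def fun_eq_iff
          kernel_op_apply funpow_deriv_flat frac_int_eq_conv simp flip: n_def)
    then show ?thesis
      using subringE(6)[OF idealizer_subring] funpow_deriv_idealizer kernel_op_idealizer
        power_kernel_integrable[OF n] by simp
  qed
qed

section \<open>The generated algebra and its smallest ideal\<close>

lemma generated_subalgebra_subset:
  assumes "subring S \<E>" "range (scalar_op T) \<subseteq> S" "G \<subseteq> S"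
  shows "generated_subalgebra T G \<subseteq> S"
proof -
  have "subalgebra (range (scalar_op T)) S \<E>"
    using assms(2) subring.axioms(1)[OF assms(1)] subringE(6)[OF assms(1)]
    by (auto simp: subalgebra_def subalgebra_axioms_def)
  then show ?thesis using assms unfolding generated_subalgebra_def by blast
qed

text \<open>
  The generators have to be linear operators on the flat functions: this makes the family of
  subalgebras that contain them nonempty, and its intersection a subring.
\<close>

lemma generated_subalgebra_subring:
  assumes "G \<subseteq> carrier \<E>"
  shows "subring (generated_subalgebra T G) \<E>"
  unfolding generated_subalgebra_def
proof (rule End.subring_Inter)
  have "subalgebra (range (scalar_op T)) (carrier \<E>) \<E>"
    using subring.axioms(1)[OF End.carrier_is_subring]
    by (auto simp: subalgebra_def subalgebra_axioms_def End_closed)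
  then show "{S. subring S \<E> \<and> subalgebra (range (scalar_op T)) S \<E> \<and> G \<subseteq> S} \<noteq> {}"
    using assms End.carrier_is_subring by blast
qed simp

theorem flat_volterra_ideal:
  "ideal (flat_volterra T) (frac_algebra T \<Gamma>)
    \<and> flat_volterra T = Idl\<^bsub>frac_algebra T \<Gamma>\<^esub> (conv_op T ` flat_space T)"
proof -
  define G where "G = range (mult_op T) \<union> frac_op T ` \<Gamma> \<union> conv_op T ` \<M>"
  define A where "A = generated_subalgebra T G"
  have R: "frac_algebra T \<Gamma> = \<E>\<lparr>carrier := A\<rparr>"
    by (simp add: frac_algebra_def A_def G_def)
  have "G \<subseteq> idealizer"
    using mult_op_idealizer frac_op_idealizer kernel_op_idealizer flat_kernel
    by (auto simp: G_def conv_op_eq_kernel_op)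
  then have A_idealizer: "A \<subseteq> idealizer"
    unfolding A_def using scalar_op_idealizer idealizer_subring
    by (intro generated_subalgebra_subset) auto
  have A_subring: "subring A \<E>"
    unfolding A_def
    by (rule generated_subalgebra_subring) (use \<open>G \<subseteq> idealizer\<close> in \<open>auto simp: idealizer_def\<close>)
  have "G \<subseteq> A" by (auto simp: A_def generated_subalgebra_def)
  then have coordinate_A: "coordinate_op \<in> A" and kernel_A: "\<And>k. k \<in> \<M> \<Longrightarrow> kernel_op k \<in> A"
    using conv_op_eq_kernel_op by (auto simp: G_def coordinate_op_def)
  have span_A: "L \<in> A" if "L \<in> flat_span" for L
    using that by induction (use coordinate_A kernel_A subringE(6,7)[OF A_subring] in auto)
  have ideal: "ideal flat_span (\<E>\<lparr>carrier := A\<rparr>)"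
  proof (rule idealI)
    show "ring (\<E>\<lparr>carrier := A\<rparr>)" by (rule End.subring_is_ring[OF A_subring])
    show "subgroup flat_span (add_monoid (\<E>\<lparr>carrier := A\<rparr>))"
      using End.add.subgroup_incl[OF flat_span_subgroup subring.axioms(1)[OF A_subring]] span_A
      by auto
  qed (use A_idealizer in \<open>auto simp: idealizer_def\<close>)
  \<comment> \<open>Minimality: the constructors of \<open>flat_span\<close> are operations that every ideal respects.\<close>
  have "flat_span \<subseteq> I" if "ideal I (\<E>\<lparr>carrier := A\<rparr>)" "conv_op T ` \<M> \<subseteq> I" for I
  proof
    interpret ideal I "\<E>\<lparr>carrier := A\<rparr>" by (rule that)
    fix L assume "L \<in> flat_span"
    then show "L \<in> I"
    proof induction
      case (conv k)
      then show ?case using that(2) conv_op_eq_kernel_op by (metis image_subset_iff)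
    next
      case (add L L')
      then show ?case
        using additive_subgroup.a_closed[OF ideal.axioms(1)[OF that(1)], of L L'] by simp
    next
      case (times L)
      then show ?case using I_l_closed coordinate_A by simp
    qed
  qed
  then have "flat_span = Idl\<^bsub>\<E>\<lparr>carrier := A\<rparr>\<^esub> (conv_op T ` \<M>)"
    using ideal conv_op_eq_kernel_op flat_span.conv unfolding genideal_def by auto
  then show ?thesis using ideal by (simp add: R flat_volterra_eq_flat_span)
qed

end

theorem corollary1:
  fixes T :: real and \<Gamma> :: "real set"
  assumes "0 < T"
    and "0 \<in> \<Gamma>"
    and "\<And>a b. a \<in> \<Gamma> \<Longrightarrow> b \<in> \<Gamma> \<Longrightarrow> a + b \<in> \<Gamma>"
    and "\<And>a. a \<in> \<Gamma> \<Longrightarrow> - a \<in> \<Gamma>"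
    and "\<int> \<subseteq> \<Gamma>"
  shows "ideal (flat_volterra T) (frac_algebra T \<Gamma>)
    \<and> flat_volterra T = Idl\<^bsub>frac_algebra T \<Gamma>\<^esub> (conv_op T ` flat_space T)"
proof -
  interpret interval T by standard (rule assms)
  show ?thesis by (rule flat_volterra_ideal)
qed

end
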